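(* Let $x_1,x_2,x_3,x_4\equiv x_0$ be four distinct points of $\mathbb{R}^2$ with pairwise distances at least $1$, such that the segments $[x_{i-1},x_i]$, $i=1,\dots,4$, are the sides of a quadrilateral $Q$. Assume moreover that $|x_1-x_3|,\ |x_2-x_4|\in[1,\sqrt2]$ and $|x_{i-1}-x_i|\in[1,\sqrt2]$ for every $i=1,\dots,4$. Then $Q$ is a square with sidelength equal to one.
   Context: All notions are standard (Euclidean plane geometry). *)

theory Defs
  imports "HOL-Analysis.Analysis"
begin

definition quadrilateral_boundary ::
  "real^2 \<Rightarrow> real^2 \<Rightarrow> real^2 \<Rightarrow> real^2 \<Rightarrow> (real^2) set" where
  "quadrilateral_boundary a b c d =
     closed_segment a b \<union> closed_segment b c \<union> closed_segment c d \<union> closed_segment d a"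

text \<open>A quadrilateral is a polygon with four sides in the usual sense: its boundary does not
  intersect itself, so that opposite sides are disjoint and adjacent sides share only their
  common vertex. It need not be convex. As a set it is the closed region enclosed by the
  boundary. The vertices are listed in cyclic order.\<close>

definition quadrilateral_with_vertices ::
  "(real^2) set \<Rightarrow> real^2 \<Rightarrow> real^2 \<Rightarrow> real^2 \<Rightarrow> real^2 \<Rightarrow> bool" where
  "quadrilateral_with_vertices Q a b c d \<longleftrightarrow>
     distinct [a, b, c, d] \<and>
     closed_segment a b \<inter> closed_segment b c = {b} \<and>
     closed_segment b c \<inter> closed_segment c d = {c} \<and>
     closed_segment c d \<inter> closed_segment d a = {d} \<and>
     closed_segment d a \<inter> closed_segment a b = {a} \<and>
     closed_segment a b \<inter> closed_segment c d = {} \<and>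
     closed_segment b c \<inter> closed_segment d a = {} \<and>
     Q = quadrilateral_boundary a b c d \<union> inside (quadrilateral_boundary a b c d)"

definition square_with_sidelength :: "real \<Rightarrow> (real^2) set \<Rightarrow> bool" where
  "square_with_sidelength s Q \<longleftrightarrow>
     (\<exists>a b c d. quadrilateral_with_vertices Q a b c d \<and>
        dist a b = s \<and> dist b c = s \<and> dist c d = s \<and> dist d a = s \<and>
        orthogonal (d - a) (b - a) \<and> orthogonal (a - b) (c - b) \<and>
        orthogonal (b - c) (d - c) \<and> orthogonal (c - d) (a - d))"

end

theory Submission
  imports Defs
begin

text \<open>
  By Radon's theorem, four points of the plane split into
  two groups whose convex hulls share a point \<open>z\<close>. Leibniz' formula expresses the squared distance
  from \<open>z\<close> to any point through the weights of \<open>z\<close> and the mutual distances of the points that span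
  it; since the squared distance from \<open>z\<close> to itself vanishes, this is an identity between the six
  squared distances, in which the pairs from different groups balance the pairs from the same group.

  If a group is a single point, the three pairs across contribute at least \<open>1\<close>, while the three
  pairs inside the other group contribute at most \<open>2 * (1/3)\<close>, which is impossible
  (\<open>not_in_triangle\<close>). If both groups are pairs, the four pairs across contribute at least \<open>1\<close> and
  the two inner pairs at most \<open>2 * (1/4)\<close> each. The bounds are tight, so the distances across equal
  \<open>1\<close> and those within the groups equal \<open>sqrt 2\<close> (\<open>meeting_segments_distances\<close>). Sides of a
  quadrilateral without a common vertex do not meet, so the two groups are the diagonals; the right
  angles then come from the law of cosines.
\<close>

lemma dist_square_bounds:
  fixes p q :: "'a::metric_space"
  assumes "dist p q \<in> {1..sqrt 2}"
  shows "1 \<le> (dist p q)\<^sup>2" "(dist p q)\<^sup>2 \<le> 2"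
proof -
  show "1 \<le> (dist p q)\<^sup>2"
    using assms by simp
  have "(dist p q)\<^sup>2 \<le> (sqrt 2)\<^sup>2"
    using assms by (intro power_mono) auto
  then show "(dist p q)\<^sup>2 \<le> 2"
    by simp
qed

text \<open>Leibniz' formula for a triangle: the second moment of the weighted points about \<open>z\<close> is the
  squared distance from \<open>z\<close> to their mean plus their variance, and the variance of weights of
  total \<open>1\<close> is the weighted sum of the mutual squared distances.\<close>

lemma leibniz_three_points:
  fixes p q r z :: "'a::real_inner"
  assumes "u + v + w = 1"
  shows "(dist (u *\<^sub>R p + v *\<^sub>R q + w *\<^sub>R r) z)\<^sup>2 =
    u * (dist p z)\<^sup>2 + v * (dist q z)\<^sup>2 + w * (dist r z)\<^sup>2
    - (u * v * (dist p q)\<^sup>2 + u * w * (dist p r)\<^sup>2 + v * w * (dist q r)\<^sup>2)"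
proof -
  have w: "w = 1 - u - v" using assms by simp
  show ?thesis
    unfolding w dist_norm power2_norm_eq_inner
    by (simp add: inner_diff inner_add inner_commute algebra_simps power2_eq_square)
qed

lemma leibniz_two_points:
  fixes p q z :: "'a::real_inner"
  shows "(dist ((1 - u) *\<^sub>R p + u *\<^sub>R q) z)\<^sup>2 =
    (1 - u) * (dist p z)\<^sup>2 + u * (dist q z)\<^sup>2 - u * (1 - u) * (dist p q)\<^sup>2"
  using leibniz_three_points[of "1 - u" u 0 p q q z] by (simp add: mult_ac)

lemma not_in_triangle:
  fixes p q r s :: "'a::real_inner"
  assumes "dist p q \<in> {1..sqrt 2}" "dist p r \<in> {1..sqrt 2}" "dist p s \<in> {1..sqrt 2}"
    and "dist q r \<in> {1..sqrt 2}" "dist q s \<in> {1..sqrt 2}" "dist r s \<in> {1..sqrt 2}"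
  shows "p \<notin> convex hull {q, r, s}"
proof
  assume "p \<in> convex hull {q, r, s}"
  then obtain u v w where uvw: "u \<ge> 0" "v \<ge> 0" "w \<ge> 0" "u + v + w = 1"
    and p: "p = u *\<^sub>R q + v *\<^sub>R r + w *\<^sub>R s"
    unfolding convex_hull_3 by auto
  have zero: "u * (dist p q)\<^sup>2 + v * (dist p r)\<^sup>2 + w * (dist p s)\<^sup>2
      = u * v * (dist q r)\<^sup>2 + u * w * (dist q s)\<^sup>2 + v * w * (dist r s)\<^sup>2"
    using leibniz_three_points[OF uvw(4), of q r s p] p by (simp add: dist_commute)
  have "u * 1 + v * 1 + w * 1 \<le> u * (dist p q)\<^sup>2 + v * (dist p r)\<^sup>2 + w * (dist p s)\<^sup>2"
    using uvw assms by (intro add_mono mult_left_mono dist_square_bounds) auto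
  moreover have "u * v * (dist q r)\<^sup>2 + u * w * (dist q s)\<^sup>2 + v * w * (dist r s)\<^sup>2
      \<le> u * v * 2 + u * w * 2 + v * w * 2"
    using uvw assms by (intro add_mono mult_left_mono dist_square_bounds) auto
  ultimately have "1 \<le> 2 * (u * v + u * w + v * w)"
    using zero uvw(4) by simp
  moreover have "(u + v + w)\<^sup>2 = 1"
    using uvw(4) by simp
  ultimately have "u\<^sup>2 + v\<^sup>2 + w\<^sup>2 \<le> 0"
    by (simp add: power2_eq_square algebra_simps)
  then have "u = 0 \<and> v = 0 \<and> w = 0"
    by (smt (verit) zero_le_power2 power2_eq_square zero_eq_power2)
  then show False
    using uvw(4) by simp
qed

text \<open>The excess of every distance over its extreme value enters the identity for the common point
  with the same sign, and so does the deviation of the weights from \<open>1/2\<close>. The latter therefore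
  vanishes first, which makes the coefficients of all the former positive.\<close>

lemma meeting_segments_distances:
  fixes p q r s :: "'a::real_inner"
  assumes meet: "closed_segment p q \<inter> closed_segment r s \<noteq> {}"
    and d: "dist p q \<in> {1..sqrt 2}" "dist r s \<in> {1..sqrt 2}"
      "dist p r \<in> {1..sqrt 2}" "dist p s \<in> {1..sqrt 2}"
      "dist q r \<in> {1..sqrt 2}" "dist q s \<in> {1..sqrt 2}"
  shows "dist p r = 1" "dist p s = 1" "dist q r = 1" "dist q s = 1"
    and "dist p q = sqrt 2" "dist r s = sqrt 2"
proof -
  obtain z where z: "z \<in> closed_segment p q" "z \<in> closed_segment r s"
    using meet by blast
  obtain u where u: "0 \<le> u" "u \<le> 1" and zu: "z = (1 - u) *\<^sub>R p + u *\<^sub>R q"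
    using z(1) unfolding in_segment by blast
  obtain v where v: "0 \<le> v" "v \<le> 1" and zv: "z = (1 - v) *\<^sub>R r + v *\<^sub>R s"
    using z(2) unfolding in_segment by blast
  note b = dist_square_bounds[OF d(1)] dist_square_bounds[OF d(2)] dist_square_bounds[OF d(3)]
    dist_square_bounds[OF d(4)] dist_square_bounds[OF d(5)] dist_square_bounds[OF d(6)]
  define PQ RS PR PS QR QS where defs: "PQ = (dist p q)\<^sup>2" "RS = (dist r s)\<^sup>2" "PR = (dist p r)\<^sup>2"
    "PS = (dist p s)\<^sup>2" "QR = (dist q r)\<^sup>2" "QS = (dist q s)\<^sup>2"
  note b = b[folded defs]
  have "(dist z r)\<^sup>2 = (1 - u) * PR + u * QR - u * (1 - u) * PQ"
    and "(dist z s)\<^sup>2 = (1 - u) * PS + u * QS - u * (1 - u) * PQ"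
    unfolding zu leibniz_two_points defs by simp_all
  moreover have "0 = (1 - v) * (dist z r)\<^sup>2 + v * (dist z s)\<^sup>2 - v * (1 - v) * RS"
    using leibniz_two_points[of v r s z] zv by (simp add: dist_commute defs)
  ultimately have "0 = (1 - v) * ((1 - u) * PR + u * QR - u * (1 - u) * PQ)
      + v * ((1 - u) * PS + u * QS - u * (1 - u) * PQ) - v * (1 - v) * RS"
    by simp
  then have zero: "(1 - v) * (1 - u) * (PR - 1) + (1 - v) * u * (QR - 1)
      + v * (1 - u) * (PS - 1) + v * u * (QS - 1)
      + u * (1 - u) * (2 - PQ) + v * (1 - v) * (2 - RS)
      + 2 * (u - 1/2)\<^sup>2 + 2 * (v - 1/2)\<^sup>2 = 0"
    by (simp add: power2_eq_square algebra_simps)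
  have "0 \<le> (1 - v) * (1 - u) * (PR - 1)" "0 \<le> (1 - v) * u * (QR - 1)"
    "0 \<le> v * (1 - u) * (PS - 1)" "0 \<le> v * u * (QS - 1)"
    "0 \<le> u * (1 - u) * (2 - PQ)" "0 \<le> v * (1 - v) * (2 - RS)"
    using u v b by simp_all
  then have "(u - 1/2)\<^sup>2 = 0" "(v - 1/2)\<^sup>2 = 0"
    using zero zero_le_power2[of "u - 1/2"] zero_le_power2[of "v - 1/2"] by linarith+
  then have half: "u = 1/2" "v = 1/2"
    by simp_all
  have "PR + QR + PS + QS + (2 - PQ) + (2 - RS) = 4"
    using zero unfolding half by (simp add: field_simps)
  then have "PR \<le> 1" "PS \<le> 1" "QR \<le> 1" "QS \<le> 1" "2 \<le> PQ" "2 \<le> RS"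
    using b by linarith+
  then have "PR = 1" "PS = 1" "QR = 1" "QS = 1" "PQ = 2" "RS = 2"
    using b by simp_all
  then show "dist p r = 1" "dist p s = 1" "dist q r = 1" "dist q s = 1"
    and "dist p q = sqrt 2" "dist r s = sqrt 2"
    unfolding defs by (metis real_sqrt_unique zero_le_dist real_sqrt_one)+
qed

text \<open>Of the two kinds of Radon partition of four points, a point against a triangle is excluded
  by \<open>not_in_triangle\<close>; what remains are the three ways to split the points into two pairs.\<close>

lemma four_points_segments_meet:
  fixes a b c d :: "'a::euclidean_space"
  assumes dim: "DIM('a) = 2"
    and ds: "dist a b \<in> {1..sqrt 2}" "dist a c \<in> {1..sqrt 2}" "dist a d \<in> {1..sqrt 2}"
      "dist b c \<in> {1..sqrt 2}" "dist b d \<in> {1..sqrt 2}" "dist c d \<in> {1..sqrt 2}"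
  shows "closed_segment a c \<inter> closed_segment b d \<noteq> {} \<or>
    closed_segment a b \<inter> closed_segment c d \<noteq> {} \<or>
    closed_segment b c \<inter> closed_segment d a \<noteq> {}"
proof -
  let ?X = "{a, b, c, d}"
  have ne: "a \<noteq> b" "a \<noteq> c" "a \<noteq> d" "b \<noteq> c" "b \<noteq> d" "c \<noteq> d"
    using ds by auto
  then have "card ?X = 4"
    by simp
  then have "affine_dependent ?X"
    using dim by (intro affine_dependent_biggerset) auto
  then obtain M P where MP: "M \<subseteq> ?X" "P \<subseteq> ?X" "M \<inter> P = {}"
    and "convex hull M \<inter> convex hull P \<noteq> {}"
    by (rule Radon)
  moreover have "convex hull P \<subseteq> convex hull (?X - M)"
    using MP by (intro hull_mono) auto
  ultimately have meet: "convex hull M \<inter> convex hull (?X - M) \<noteq> {}"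
    by blast
  have out: "a \<notin> convex hull {b, c, d}" "b \<notin> convex hull {a, c, d}"
    "c \<notin> convex hull {a, b, d}" "d \<notin> convex hull {a, b, c}"
    using ds by (intro not_in_triangle; simp add: dist_commute)+
  \<comment> \<open>Spelling out \<open>M\<close> and its complement by membership lets a case split enumerate all partitions.\<close>
  have M: "M = (if a \<in> M then {a} else {}) \<union> (if b \<in> M then {b} else {})
      \<union> (if c \<in> M then {c} else {}) \<union> (if d \<in> M then {d} else {})"
    using MP(1) by auto
  have rest: "?X - M = (if a \<in> M then {} else {a}) \<union> (if b \<in> M then {} else {b})
      \<union> (if c \<in> M then {} else {c}) \<union> (if d \<in> M then {} else {d})"
    by auto
  have "convex hull ((if a \<in> M then {a} else {}) \<union> (if b \<in> M then {b} else {})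
      \<union> (if c \<in> M then {c} else {}) \<union> (if d \<in> M then {d} else {}))
    \<inter> convex hull ((if a \<in> M then {} else {a}) \<union> (if b \<in> M then {} else {b})
      \<union> (if c \<in> M then {} else {c}) \<union> (if d \<in> M then {} else {d})) \<noteq> {}"
    using meet by (simp only: M[symmetric] rest[symmetric] not_False_eq_True)
  then show ?thesis
    using out
    by (cases "a \<in> M"; cases "b \<in> M"; cases "c \<in> M"; cases "d \<in> M")
      (simp_all add: segment_convex_hull insert_commute Int_commute)
qed

text \<open>The converse of Pythagoras' theorem for an isosceles triangle with legs of length \<open>1\<close>.\<close>

lemma orthogonal_if_unit_legs:
  fixes p q r :: "'a::real_inner"
  assumes "dist p q = 1" "dist p r = 1" "dist q r = sqrt 2"
  shows "orthogonal (q - p) (r - p)"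
proof -
  have "(norm (q - r))\<^sup>2 = (norm (q - p))\<^sup>2 + (norm (r - p))\<^sup>2 - 2 * ((q - p) \<bullet> (r - p))"
    unfolding power2_norm_eq_inner by (simp add: inner_diff inner_commute algebra_simps)
  moreover have "norm (q - p) = 1" "norm (r - p) = 1" "norm (q - r) = sqrt 2"
    using assms by (simp_all add: dist_norm norm_minus_commute)
  ultimately show ?thesis
    by (simp add: orthogonal_def)
qed

theorem lemma2p2:
  fixes x :: "nat \<Rightarrow> real^2" and Q :: "(real^2) set"
  assumes "x 0 = x 4"
    and "inj_on x {1..4}"
    and "\<forall>i\<in>{1..4}. \<forall>j\<in>{1..4}. i \<noteq> j \<longrightarrow> dist (x i) (x j) \<ge> 1"
    and "quadrilateral_with_vertices Q (x 1) (x 2) (x 3) (x 4)"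
    and "dist (x 1) (x 3) \<in> {1..sqrt 2}"
    and "dist (x 2) (x 4) \<in> {1..sqrt 2}"
    and "\<forall>i\<in>{1..4}. dist (x (i - 1)) (x i) \<in> {1..sqrt 2}"
  shows "square_with_sidelength 1 Q"
proof -
  have s: "dist (x 4) (x 1) \<in> {1..sqrt 2}" "dist (x 1) (x 2) \<in> {1..sqrt 2}"
    "dist (x 2) (x 3) \<in> {1..sqrt 2}" "dist (x 3) (x 4) \<in> {1..sqrt 2}"
    using assms(1) assms(7)[rule_format, of 1] assms(7)[rule_format, of 2]
      assms(7)[rule_format, of 3] assms(7)[rule_format, of 4] by simp_all
  have s41: "dist (x 1) (x 4) \<in> {1..sqrt 2}"
    using s(1) by (simp add: dist_commute)
  have "closed_segment (x 1) (x 2) \<inter> closed_segment (x 3) (x 4) = {}"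
    "closed_segment (x 2) (x 3) \<inter> closed_segment (x 4) (x 1) = {}"
    using assms(4) unfolding quadrilateral_with_vertices_def by blast+
  then have meet: "closed_segment (x 1) (x 3) \<inter> closed_segment (x 2) (x 4) \<noteq> {}"
    using four_points_segments_meet[OF _ s(2) assms(5) s41 s(3) assms(6) s(4)] by auto
  have s32: "dist (x 3) (x 2) \<in> {1..sqrt 2}"
    using s(3) by (simp add: dist_commute)
  note eq = meeting_segments_distances[OF meet assms(5,6) s(2) s41 s32 s(4)]
  have "orthogonal (x 4 - x 1) (x 2 - x 1)" "orthogonal (x 1 - x 2) (x 3 - x 2)"
    "orthogonal (x 2 - x 3) (x 4 - x 3)" "orthogonal (x 3 - x 4) (x 1 - x 4)"
    using eq by (auto intro!: orthogonal_if_unit_legs simp: dist_commute)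
  moreover have "dist (x 1) (x 2) = 1" "dist (x 2) (x 3) = 1" "dist (x 3) (x 4) = 1"
    "dist (x 4) (x 1) = 1"
    using eq by (simp_all add: dist_commute)
  ultimately show ?thesis
    using assms(4) unfolding square_with_sidelength_def by blast
qed

end
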